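(* Let $\ell\ge2$, $m=(2\ell+1)^d$, and let $R\in\mathbb{C}^{m\times m}$ be a Hermitian positive semidefinite generalized Toeplitz matrix (indexed by $\Omega_\ell=\{-\ell,\dots,\ell\}^d$). If $R$ is flat, then there exists a positive $(\operatorname{rank}R)$-sparse Borel measure $\nu$ on $\mathbb{T}^d$ such that $R$ is the moment matrix of $\nu$.
   Context: $\mathbb{T}^d=(\mathbb{R}/\mathbb{Z})^d$. Rows and columns of $R$ are indexed by $\Omega_\ell=\{-\ell,\dots,\ell\}^d$. Generalized Toeplitz: $R_{i+k,j+k}=R_{i,j}$ for all $i,j,k\in\Omega_\ell$ with $\|i+k\|_\infty\le\ell$ and $\|j+k\|_\infty\le\ell$. Flat: $\operatorname{rank}R=\operatorname{rank}A$, where $A=(R_{i,j})_{i,j\in\Omega_{\ell-1}}$ is the submatrix of $R$ with rows and columns indexed by $\Omega_{\ell-1}=\{-(\ell-1),\dots,\ell-1\}^d$. $R$ is the (trigonometric) moment matrix of $\nu$ if $R_{i,j}=\int_{\mathbb{T}^d}e^{-2i\pi\langle i-j,x\rangle}\,\mathrm{d}\nu(x)$ for all $i,j\in\Omega_\ell$ (the $i$ in front of $\pi$ being the imaginary unit). A positive measure is $r$-sparse if it is of the form $\sum_{n=1}^r a_n\delta_{x_n}$ with $a_n>0$ and pairwise distinct points $x_n\in\mathbb{T}^d$. *)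

theory Defs
  imports
    "HOL-Analysis.Analysis"
    "HOL-Library.Function_Algebras"
    "HOL-Probability.Giry_Monad"
begin

section \<open>Matrices indexed by finite sets\<close>

text \<open>
  The index set \<open>\<Omega>\<^sub>\<ell> = {-\<ell>,\<dots>,\<ell>}\<^sup>d\<close> depends on the number \<open>\<ell>\<close>, so a matrix is a function of two
  indices together with an explicit finite index set \<open>S\<close>; its values outside \<open>S \<times> S\<close> play no role.
  The dimension \<open>d\<close> is \<open>CARD('d)\<close>.
\<close>

definition Omega :: "nat \<Rightarrow> (int ^ 'd) set" where
  "Omega l = {k. \<forall>n. \<bar>k $ n\<bar> \<le> int l}"

definition hermitian_on :: "'i set \<Rightarrow> ('i \<Rightarrow> 'i \<Rightarrow> complex) \<Rightarrow> bool" where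
  "hermitian_on S M \<longleftrightarrow> (\<forall>i\<in>S. \<forall>j\<in>S. M j i = cnj (M i j))"

definition pos_semidef_on :: "'i set \<Rightarrow> ('i \<Rightarrow> 'i \<Rightarrow> complex) \<Rightarrow> bool" where
  "pos_semidef_on S M \<longleftrightarrow>
     (\<forall>v. (\<Sum>i\<in>S. \<Sum>j\<in>S. cnj (v i) * M i j * v j) \<in> \<real>\<^sub>\<ge>\<^sub>0)"

global_interpretation fun_space: vector_space "\<lambda>(c::complex) (f::'i \<Rightarrow> complex) x. c * f x"
  by unfold_locales (auto simp: fun_eq_iff algebra_simps)

text \<open>
  Like the library constant \<^const>\<open>rank\<close>, this is the dimension of the row space. The rows
  of the \<open>S \<times> S\<close> matrix are extended by zero to functions on the whole index type.
\<close>

definition rank_on :: "'i set \<Rightarrow> ('i \<Rightarrow> 'i \<Rightarrow> complex) \<Rightarrow> nat" where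
  "rank_on S M = fun_space.dim ((\<lambda>i j. if j \<in> S then M i j else 0) ` S)"

lemma rank_on_UNIV:
  fixes A :: "complex ^ 'n ^ 'n"
  shows "rank_on UNIV (\<lambda>i j. A $ i $ j) = rank A"
proof -
  interpret vector_space_pair "(*s) :: complex \<Rightarrow> complex ^ 'n \<Rightarrow> complex ^ 'n"
    "\<lambda>(c::complex) (f::'n \<Rightarrow> complex) x. c * f x" ..
  have lin: "Vector_Spaces.linear ((*s) :: complex \<Rightarrow> complex ^ 'n \<Rightarrow> _)
      (\<lambda>(c::complex) (f::'n \<Rightarrow> complex) x. c * f x) vec_nth"
    by unfold_locales (auto simp: fun_eq_iff)
  obtain B where B: "B \<subseteq> rows A" "vec.independent B" "rows A \<subseteq> vec.span B" "card B = vec.dim (rows A)"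
    using vec.basis_exists[of "rows A"] by blast
  have inj: "inj (vec_nth :: complex ^ 'n \<Rightarrow> _)"
    by (auto simp: inj_on_def vec_eq_iff)
  have "fun_space.independent (vec_nth ` B)"
    using linear_independent_injective_image[OF lin B(2)] inj by (auto intro: inj_on_subset)
  moreover have "vec_nth ` rows A \<subseteq> fun_space.span (vec_nth ` B)"
    using linear_span_image[OF lin] B(3) by auto
  ultimately have "fun_space.dim (vec_nth ` rows A) = card (vec_nth ` B)"
    using fun_space.basis_card_eq_dim[of "vec_nth ` B" "vec_nth ` rows A"] B(1)
    by (metis image_mono)
  also have "\<dots> = rank A"
    using B(4) inj by (simp add: card_image inj_on_subset row_rank_def_gen)
  finally show ?thesis
    by (simp add: rank_on_def rows_def row_def image_Collect full_SetCompr_eq image_image)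
qed

definition gen_toeplitz :: "nat \<Rightarrow> (int ^ 'd \<Rightarrow> int ^ 'd \<Rightarrow> complex) \<Rightarrow> bool" where
  "gen_toeplitz l R \<longleftrightarrow>
     (\<forall>i\<in>Omega l. \<forall>j\<in>Omega l. \<forall>k\<in>Omega l.
        i + k \<in> Omega l \<longrightarrow> j + k \<in> Omega l \<longrightarrow> R (i + k) (j + k) = R i j)"

definition flat :: "nat \<Rightarrow> (int ^ 'd \<Rightarrow> int ^ 'd \<Rightarrow> complex) \<Rightarrow> bool" where
  "flat l R \<longleftrightarrow> rank_on (Omega l) R = rank_on (Omega (l - 1)) R"

section \<open>The torus\<close>

quotient_type circle = real / "\<lambda>x y. x - y \<in> \<int>"
  morphisms rep_circle abs_circle
proof (rule equivpI)
  show "reflp (\<lambda>x y::real. x - y \<in> \<int>)"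
    by (simp add: reflp_def)
  show "symp (\<lambda>x y::real. x - y \<in> \<int>)"
    by (metis (no_types, lifting) Ints_minus minus_diff_eq sympI)
  show "transp (\<lambda>x y::real. x - y \<in> \<int>)"
  proof (rule transpI)
    fix x y z :: real assume "x - y \<in> \<int>" "y - z \<in> \<int>"
    then have "(x - y) + (y - z) \<in> \<int>" by (rule Ints_add)
    then show "x - z \<in> \<int>" by simp
  qed
qed

instantiation circle :: topological_space
begin

definition open_circle :: "circle set \<Rightarrow> bool" where
  "open_circle U \<longleftrightarrow> open (abs_circle -` U)"

instance
  by standard (auto simp: open_circle_def vimage_Int vimage_Union)

end

text \<open>
  The torus \<open>(\<real>/\<int>)\<^sup>d\<close> is \<open>circle ^ 'd\<close>, with the library's product topology and its Borel sets.
  The character \<open>x \<mapsto> exp (-2\<pi>i \<langle>k,x\<rangle>)\<close> is written with real representatives of the coordinates;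
  the lemma below shows that their choice does not matter.
\<close>

definition character :: "int ^ 'd \<Rightarrow> circle ^ 'd \<Rightarrow> complex" where
  "character k x =
     exp (- 2 * \<i> * of_real pi * of_real (\<Sum>n\<in>UNIV. of_int (k $ n) * rep_circle (x $ n)))"

lemma rep_abs_circle: "rep_circle (abs_circle y) - y \<in> \<int>"
  using Quotient_rep_abs[OF Quotient_circle, of y] by simp

lemma character_abs_circle:
  "character k (\<chi> n. abs_circle (y $ n)) =
     exp (- 2 * \<i> * of_real pi * of_real (\<Sum>n\<in>UNIV. of_int (k $ n) * (y $ n)))"
proof -
  have "(\<Sum>n\<in>UNIV. of_int (k $ n) * (rep_circle (abs_circle (y $ n)) - y $ n)) \<in> \<int>"
    by (intro Ints_sum Ints_mult rep_abs_circle) auto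
  then obtain N where
    "(\<Sum>n\<in>UNIV. of_int (k $ n) * (rep_circle (abs_circle (y $ n)) - y $ n)) = of_int N"
    by (auto elim: Ints_cases)
  then have N: "(\<Sum>n\<in>UNIV. of_int (k $ n) * rep_circle (abs_circle (y $ n))) =
      (\<Sum>n\<in>UNIV. of_int (k $ n) * (y $ n)) + of_int N"
    by (simp add: right_diff_distrib sum_subtractf)
  show ?thesis
    unfolding character_def vec_lambda_beta N
    unfolding exp_eq by (rule exI[of _ "- N"]) (simp add: algebra_simps)
qed

definition moment_matrix_of ::
  "nat \<Rightarrow> (int ^ 'd \<Rightarrow> int ^ 'd \<Rightarrow> complex) \<Rightarrow> (circle ^ 'd) measure \<Rightarrow> bool" where
  "moment_matrix_of l R \<nu> \<longleftrightarrow>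
     (\<forall>i\<in>Omega l. \<forall>j\<in>Omega l. R i j = (\<integral>x. character (i - j) x \<partial>\<nu>))"

text \<open>
  Borel measures of the form \<open>\<Sum>n=1..r. a n *\<^sub>R \<delta> (x n)\<close> with positive weights and pairwise distinct
  points; \<open>return borel x\<close> is the Dirac measure at \<open>x\<close>.
\<close>

definition sparse_measure :: "nat \<Rightarrow> 'a::topological_space measure \<Rightarrow> bool" where
  "sparse_measure r \<nu> \<longleftrightarrow> sets \<nu> = sets borel \<and>
     (\<exists>(a :: nat \<Rightarrow> real) x. (\<forall>n\<in>{1..r}. 0 < a n) \<and> inj_on x {1..r} \<and>
        (\<forall>B\<in>sets borel. emeasure \<nu> B = (\<Sum>n=1..r. ennreal (a n) * emeasure (return borel (x n)) B)))"

end

theory Submission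
  imports Defs "HOL-Computational_Algebra.Fundamental_Theorem_Algebra"
begin

text \<open>
  The matrix is the Gram matrix of the vectors \<open>U\<^sup>i v\<close>, where \<open>U = (U\<^sub>1, \<dots>, U\<^sub>d)\<close> are commuting unitary
  operators, and the atoms are the joint eigenvalues of these operators.

  Let \<open>W\<close> be the row space of \<open>R\<close>, a space of functions on \<open>\<Omega>\<^sub>\<ell>\<close>. The form \<open>(f, g) \<mapsto> f R g\<^sup>*\<close> makes it
  a Hilbert space. Flatness says that the rows with index in \<open>\<Omega>\<^bsub>\<ell>-1\<^esub>\<close> already span \<open>W\<close>. They can be
  moved by a unit vector \<open>e\<^sub>n\<close> without leaving \<open>\<Omega>\<^sub>\<ell>\<close>, and by the Toeplitz property moving the rows moves
  the functions: \<open>(U\<^sub>n w) j = w (j - e\<^sub>n)\<close> wherever both sides make sense. Positivity makes an element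
  of \<open>W\<close> determined by its values on \<open>\<Omega>\<^bsub>\<ell>-1\<^esub>\<close> (\<open>W_eqI\<close>), so this formula defines \<open>U\<^sub>n\<close> without
  ambiguity, and the maps \<open>U\<^sub>n\<close> are linear, commute (\<open>shift_commute\<close>) and have unimodular
  eigenvalues (\<open>norm_shift_eigenvalue\<close>). If \<open>W \<noteq> 0\<close>, they have a common eigenvector. Its values on
  \<open>\<Omega>\<^sub>\<ell>\<close> follow from its value at \<open>0\<close> by unit steps, so it is a multiple of the character
  \<open>j \<mapsto> exp (2\<pi>i \<langle>j,x\<rangle>)\<close> for some point \<open>x\<close> of the torus (\<open>exists_atom_row_in_W\<close>).

  Instead of diagonalising the \<open>U\<^sub>n\<close> simultaneously, the proof splits off one atom at a time
  (\<open>split_off_atom\<close>). If the character \<open>p\<close> is the combination \<open>p = f R\<close> of rows and \<open>a = f R f\<^sup>*\<close>, then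
  \<open>R - p\<^sup>* p / a\<close> is again positive semidefinite, by the Cauchy-Schwarz argument, and Toeplitz, since
  \<open>p\<^sup>* p\<close> depends on the difference of the indices only. It is flat, since it inherits the linear
  relations between the rows of \<open>R\<close>, and \<open>p\<close> has left its row space, so its rank is smaller by exactly
  one. Induction on the rank then gives \<open>rank R\<close> atoms with weights \<open>1 / a\<close>. They are distinct because
  all characters found later lie in a row space that does not contain \<open>p\<close>.
\<close>

section \<open>Common eigenvectors of commuting maps\<close>

lemma sum_fun_apply: "(\<Sum>a\<in>A. f a) x = (\<Sum>a\<in>A. f a x)"
  by (induction A rule: infinite_finite_induct) auto

text \<open>
  Stated for sequences and not for sets, so that a repeated vector counts as a dependence.
\<close>

lemma linear_dependence_of_sequence:
  fixes f :: "nat \<Rightarrow> 'i \<Rightarrow> complex"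
  assumes fin: "finite B" and f: "\<And>i. f i \<in> fun_space.span B"
  shows "\<exists>u. (\<exists>i\<le>card B. u i \<noteq> 0) \<and> (\<forall>x. (\<Sum>i\<le>card B. u i * f i x) = 0)"
proof (cases "inj_on f {..card B}")
  case True
  have "card (f ` {..card B}) = Suc (card B)"
    using True by (simp add: card_image)
  moreover have "f ` {..card B} \<subseteq> fun_space.span B"
    using f by auto
  ultimately have "fun_space.dependent (f ` {..card B})"
    using fun_space.independent_span_bound[OF fin, of "f ` {..card B}"] by auto
  then obtain u where u: "\<exists>v\<in>f ` {..card B}. u v \<noteq> 0"
      "(\<Sum>v\<in>f ` {..card B}. (\<lambda>x. u v * v x)) = 0"
    using fun_space.dependent_finite[of "f ` {..card B}"] by auto
  have "(\<Sum>i\<le>card B. u (f i) * f i x) = 0" for x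
  proof -
    have "(\<Sum>i\<le>card B. u (f i) * f i x) = (\<Sum>v\<in>f ` {..card B}. u v * v x)"
      using True by (simp add: sum.reindex)
    also have "\<dots> = (\<Sum>v\<in>f ` {..card B}. (\<lambda>x. u v * v x)) x"
      by (simp add: sum_fun_apply)
    finally show ?thesis using u(2) by simp
  qed
  with u(1) show ?thesis by (intro exI[of _ "\<lambda>i. u (f i)"]) auto
next
  case False
  then obtain i j where ij: "i \<le> card B" "j \<le> card B" "i \<noteq> j" "f i = f j"
    by (auto simp: inj_on_def)
  have "(\<Sum>k\<le>card B. ((if k = i then 1 else 0) - (if k = j then 1 else 0)) * f k x) = f i x - f j x"
    for x
    using ij(1,2) by (simp add: left_diff_distrib sum_subtractf if_distrib[of "\<lambda>c. c * _"] cong: if_cong)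
  with ij show ?thesis
    by (intro exI[of _ "\<lambda>k. (if k = i then 1 else 0) - (if k = j then 1 else 0)"]) auto
qed

text \<open>
  A nonzero polynomial \<open>p\<close> of least degree with \<open>p(T) w = 0\<close> has a root \<open>c\<close>. Dividing out the factor
  \<open>X - c\<close> leaves \<open>q\<close> with \<open>q(T) w \<noteq> 0\<close> by minimality, and \<open>T - c\<close> annihilates \<open>q(T) w\<close>. Linearity is
  stated on the subspace, because the shifts below are determined by their effect on the row space alone.
\<close>

lemma eigenvector_exists:
  fixes T :: "('i \<Rightarrow> complex) \<Rightarrow> 'i \<Rightarrow> complex"
  assumes sub: "fun_space.subspace E" and fin: "finite B" and EB: "E \<subseteq> fun_space.span B"
    and closed: "\<And>v. v \<in> E \<Longrightarrow> T v \<in> E"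
    and add: "\<And>v w. v \<in> E \<Longrightarrow> w \<in> E \<Longrightarrow> T (v + w) = T v + T w"
    and scale: "\<And>c v. v \<in> E \<Longrightarrow> T (\<lambda>x. c * v x) = (\<lambda>x. c * T v x)"
    and w: "w \<in> E" "w \<noteq> 0"
  shows "\<exists>c. \<exists>v\<in>E. v \<noteq> 0 \<and> T v = (\<lambda>x. c * v x)"
proof -
  \<comment> \<open>The vector \<open>p(T) w\<close>.\<close>
  define ev where "ev p = (\<lambda>x. \<Sum>i\<le>degree p. coeff p i * (T ^^ i) w x)" for p :: "complex poly"
  have iter: "(T ^^ i) w \<in> E" for i
    by (induction i) (auto simp: closed w)
  have ev_upto: "ev p = (\<Sum>i\<le>N. (\<lambda>x. coeff p i * (T ^^ i) w x))" if "degree p \<le> N" for p N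
  proof -
    have "(\<Sum>i\<le>degree p. coeff p i * (T ^^ i) w x) = (\<Sum>i\<le>N. coeff p i * (T ^^ i) w x)" for x
      using that by (intro sum.mono_neutral_left) (auto simp: coeff_eq_0)
    then show ?thesis by (auto simp: ev_def fun_eq_iff sum_fun_apply)
  qed
  have evE: "ev p \<in> E" for p
    unfolding ev_upto[of p "degree p", OF order_refl]
    by (rule fun_space.subspace_sum[OF sub]) (rule fun_space.subspace_scale[OF sub iter])
  have zero: "T 0 = 0"
    using scale[OF w(1), of 0] by (simp add: zero_fun_def)
  have T_sum: "T (\<Sum>i\<in>I. (\<lambda>x. a i * g i x)) = (\<Sum>i\<in>I. (\<lambda>x. a i * T (g i) x))"
    if "\<And>i. g i \<in> E" for I :: "nat set" and a g
  proof (induction I rule: infinite_finite_induct)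
    case (insert i I)
    have "(\<Sum>i\<in>I. (\<lambda>x. a i * g i x)) \<in> E"
      by (rule fun_space.subspace_sum[OF sub]) (rule fun_space.subspace_scale[OF sub that])
    moreover have "(\<lambda>x. a i * g i x) \<in> E"
      by (rule fun_space.subspace_scale[OF sub that])
    ultimately have "T ((\<lambda>x. a i * g i x) + (\<Sum>i\<in>I. (\<lambda>x. a i * g i x)))
        = T (\<lambda>x. a i * g i x) + T (\<Sum>i\<in>I. (\<lambda>x. a i * g i x))"
      by (rule add[rotated])
    moreover have "T (\<lambda>x. a i * g i x) = (\<lambda>x. a i * T (g i) x)"
      by (rule scale[OF that])
    ultimately show ?case
      unfolding sum.insert[OF insert.hyps(1,2)] using insert.IH by metis
  qed (simp_all only: sum.infinite sum.empty zero not_False_eq_True)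
  have ev_root: "ev ([:-c, 1:] * q) = T (ev q) - (\<lambda>x. c * ev q x)" for c q
  proof -
    define N where "N = degree q"
    have "degree ([:-c, 1:] * q) \<le> Suc N"
      using degree_mult_le[of "[:-c, 1:]" q] by (simp add: N_def)
    then have "ev ([:-c, 1:] * q) = (\<Sum>i\<le>Suc N. (\<lambda>x. coeff ([:-c, 1:] * q) i * (T ^^ i) w x))"
      by (rule ev_upto)
    also have "\<dots> = (\<Sum>i\<le>Suc N. (\<lambda>x. coeff (pCons 0 q) i * (T ^^ i) w x)) -
        (\<lambda>x. c * (\<Sum>i\<le>Suc N. (\<lambda>x. coeff q i * (T ^^ i) w x)) x)"
    proof
      fix x
      have "[:-c, 1:] * q = pCons 0 q - smult c q" by simp
      then have "coeff ([:-c, 1:] * q) i = coeff (pCons 0 q) i - c * coeff q i" for i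
        by (simp only: coeff_diff coeff_smult)
      then show "(\<Sum>i\<le>Suc N. (\<lambda>x. coeff ([:-c, 1:] * q) i * (T ^^ i) w x)) x =
          ((\<Sum>i\<le>Suc N. (\<lambda>x. coeff (pCons 0 q) i * (T ^^ i) w x)) -
          (\<lambda>x. c * (\<Sum>i\<le>Suc N. (\<lambda>x. coeff q i * (T ^^ i) w x)) x)) x"
        by (simp only: fun_diff_def sum_fun_apply sum_distrib_left sum_subtractf[symmetric]
            left_diff_distrib mult.assoc)
    qed
    also have "(\<Sum>i\<le>Suc N. (\<lambda>x. coeff q i * (T ^^ i) w x)) = ev q"
      by (rule ev_upto[symmetric]) (simp add: N_def)
    also have "(\<Sum>i\<le>Suc N. (\<lambda>x. coeff (pCons 0 q) i * (T ^^ i) w x)) =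
        (\<Sum>i\<le>N. (\<lambda>x. coeff q i * T ((T ^^ i) w) x))"
      unfolding sum.atMost_Suc_shift by (auto simp: fun_eq_iff)
    also have "\<dots> = T (ev q)"
      unfolding ev_upto[of q "degree q", OF order_refl] T_sum[OF iter] N_def ..
    finally show ?thesis .
  qed
  have "\<exists>p. p \<noteq> 0 \<and> ev p = 0"
  proof -
    obtain u where u: "\<exists>i\<le>card B. u i \<noteq> 0" "\<And>x. (\<Sum>i\<le>card B. u i * (T ^^ i) w x) = 0"
      using linear_dependence_of_sequence[OF fin, of "\<lambda>i. (T ^^ i) w"] iter EB by blast
    define p where "p = (\<Sum>i\<le>card B. monom (u i) i)"
    have coeff: "coeff p i = (if i \<le> card B then u i else 0)" for i
      by (simp add: p_def coeff_sum)
    have "degree p \<le> card B"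
      by (intro degree_le) (simp add: coeff)
    then have "ev p = (\<Sum>i\<le>card B. (\<lambda>x. coeff p i * (T ^^ i) w x))"
      by (rule ev_upto)
    then have "ev p = 0"
      using u(2) by (simp add: fun_eq_iff sum_fun_apply coeff)
    moreover obtain i where "i \<le> card B" "u i \<noteq> 0" using u(1) by blast
    then have "coeff p i \<noteq> 0" by (simp add: coeff)
    then have "p \<noteq> 0" by auto
    ultimately show ?thesis by blast
  qed
  then obtain p where p: "p \<noteq> 0" "ev p = 0"
    and least: "\<And>q. q \<noteq> 0 \<Longrightarrow> ev q = 0 \<Longrightarrow> degree p \<le> degree q"
    using ex_has_least_nat[of "\<lambda>p. p \<noteq> 0 \<and> ev p = 0" _ degree] by blast
  have "degree p \<noteq> 0"
  proof
    assume "degree p = 0"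
    then obtain c where "p = [:c:]" by (auto elim: degree_eq_zeroE)
    with p w(2) show False by (auto simp: ev_def fun_eq_iff)
  qed
  then obtain c where "poly p c = 0"
    using fundamental_theorem_of_algebra[of p] by (auto simp: constant_degree)
  then obtain q where q: "p = [:-c, 1:] * q"
    by (auto simp: poly_eq_0_iff_dvd elim: dvdE)
  with p have "q \<noteq> 0" by auto
  then have "degree p = degree [:-c, 1:] + degree q"
    unfolding q by (intro degree_mult_eq) auto
  then have "degree q < degree p" by simp
  with least \<open>q \<noteq> 0\<close> have "ev q \<noteq> 0" by fastforce
  moreover have "T (ev q) = (\<lambda>x. c * ev q x)"
    using p(2) unfolding q ev_root by (simp add: fun_eq_iff)
  ultimately show ?thesis using evE by blast
qed

text \<open>
  Induction on the set of maps: an eigenspace of one map is invariant under all maps that commute with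
  it, so the next eigenvector can be sought inside it.
\<close>

lemma common_eigenvector_exists:
  fixes T :: "'n \<Rightarrow> ('i \<Rightarrow> complex) \<Rightarrow> 'i \<Rightarrow> complex"
  assumes "finite F" and sub: "fun_space.subspace W" and fin: "finite B" and WB: "W \<subseteq> fun_space.span B"
    and closed: "\<And>n v. v \<in> W \<Longrightarrow> T n v \<in> W"
    and add: "\<And>n v w. v \<in> W \<Longrightarrow> w \<in> W \<Longrightarrow> T n (v + w) = T n v + T n w"
    and scale: "\<And>n c v. v \<in> W \<Longrightarrow> T n (\<lambda>x. c * v x) = (\<lambda>x. c * T n v x)"
    and commute: "\<And>m n v. v \<in> W \<Longrightarrow> T m (T n v) = T n (T m v)"
    and w: "w \<in> W" "w \<noteq> 0"
  shows "\<exists>v\<in>W. v \<noteq> 0 \<and> (\<forall>n\<in>F. \<exists>c. T n v = (\<lambda>x. c * v x))"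
proof -
  have "\<exists>E. E \<subseteq> W \<and> fun_space.subspace E \<and> (\<exists>v\<in>E. v \<noteq> 0) \<and> (\<forall>n. \<forall>v\<in>E. T n v \<in> E) \<and>
      (\<forall>n\<in>F. \<exists>c. \<forall>v\<in>E. T n v = (\<lambda>x. c * v x))"
    using \<open>finite F\<close>
  proof (induction F rule: finite_induct)
    case empty
    show ?case
    proof (intro exI[of _ W] conjI)
      show "\<exists>v\<in>W. v \<noteq> 0" using w by blast
    qed (use sub closed in auto)
  next
    case (insert m F)
    then obtain E where E: "E \<subseteq> W" "fun_space.subspace E" "\<exists>v\<in>E. v \<noteq> 0" "\<And>n v. v \<in> E \<Longrightarrow> T n v \<in> E"
        "\<forall>n\<in>F. \<exists>c. \<forall>v\<in>E. T n v = (\<lambda>x. c * v x)"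
      by blast
    have "\<exists>c. \<exists>v\<in>E. v \<noteq> 0 \<and> T m v = (\<lambda>x. c * v x)"
    proof -
      obtain u where u: "u \<in> E" "u \<noteq> 0" using E(3) by blast
      have W: "\<And>v. v \<in> E \<Longrightarrow> v \<in> W" and EB: "E \<subseteq> fun_space.span B"
        using E(1) WB by blast+
      show ?thesis
        by (rule eigenvector_exists[OF E(2) fin EB E(4) add[OF W W] scale[OF W] u])
    qed
    then obtain c v where v: "v \<in> E" "v \<noteq> 0" "T m v = (\<lambda>x. c * v x)" by blast
    define E' where "E' = {v\<in>E. T m v = (\<lambda>x. c * v x)}"
    have "T m 0 = 0"
      using scale[OF w(1), of m 0] by (simp add: zero_fun_def)
    have "fun_space.subspace E'"
      unfolding fun_space.subspace_def
    proof (intro conjI ballI allI)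
      show "0 \<in> E'"
        using fun_space.subspace_0[OF E(2)] \<open>T m 0 = 0\<close> by (auto simp: E'_def fun_eq_iff)
    next
      fix x y assume "x \<in> E'" "y \<in> E'"
      then have xy: "x \<in> E" "y \<in> E" "T m x = (\<lambda>i. c * x i)" "T m y = (\<lambda>i. c * y i)"
        by (auto simp: E'_def)
      then have "T m (x + y) = T m x + T m y"
        using E(1) by (intro add) auto
      with xy have "T m (x + y) = (\<lambda>i. c * (x + y) i)"
        by (simp only: plus_fun_def distrib_left)
      then show "x + y \<in> E'"
        unfolding E'_def using fun_space.subspace_add[OF E(2) xy(1,2)] by blast
    next
      fix a x assume "x \<in> E'"
      then have x: "x \<in> E" "T m x = (\<lambda>i. c * x i)"
        by (auto simp: E'_def)
      then have "T m (\<lambda>i. a * x i) = (\<lambda>i. a * T m x i)"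
        using E(1) by (intro scale) auto
      with x have "T m (\<lambda>i. a * x i) = (\<lambda>i. c * (a * x i))"
        by (simp only: mult.left_commute)
      then show "(\<lambda>i. a * x i) \<in> E'"
        unfolding E'_def using fun_space.subspace_scale[OF E(2) x(1)] by blast
    qed
    moreover have "T n u \<in> E'" if "u \<in> E'" for n u
    proof -
      have "u \<in> W" "T m u = (\<lambda>x. c * u x)" using that E(1) by (auto simp: E'_def)
      then have "T m (T n u) = (\<lambda>x. c * T n u x)"
        using commute[of u m n] scale[of u n c] by simp
      moreover have "T n u \<in> E"
        using that E(4) by (auto simp: E'_def)
      ultimately show ?thesis by (simp add: E'_def)
    qed
    moreover have "E' \<subseteq> W" "\<exists>v\<in>E'. v \<noteq> 0"
      using E(1) v by (auto simp: E'_def)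
    moreover have "\<forall>n\<in>insert m F. \<exists>c. \<forall>v\<in>E'. T n v = (\<lambda>x. c * v x)"
      using E(5) unfolding E'_def by blast
    ultimately show ?case by blast
  qed
  then obtain E v where "E \<subseteq> W" "v \<in> E" "v \<noteq> 0"
      and scalar: "\<forall>n\<in>F. \<exists>c. \<forall>v\<in>E. T n v = (\<lambda>x. c * v x)"
    by blast
  moreover have "\<forall>n\<in>F. \<exists>c. T n v = (\<lambda>x. c * v x)"
    using scalar \<open>v \<in> E\<close> by blast
  ultimately show ?thesis by blast
qed

section \<open>Positive semidefinite sesquilinear forms\<close>

text \<open>
  The form of \<open>R\<close> is written with row vectors: the first argument multiplies from the left and is not
  conjugated. It thus pairs with combinations of rows, in terms of which the rank is defined.
\<close>

definition sesq :: "'i set \<Rightarrow> ('i \<Rightarrow> 'i \<Rightarrow> complex) \<Rightarrow> ('i \<Rightarrow> complex) \<Rightarrow> ('i \<Rightarrow> complex) \<Rightarrow> complex" where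
  "sesq S R g h = (\<Sum>i\<in>S. \<Sum>j\<in>S. g i * R i j * cnj (h j))"

lemma pos_semidef_on_iff_sesq: "pos_semidef_on S R \<longleftrightarrow> (\<forall>g. sesq S R g g \<in> \<real>\<^sub>\<ge>\<^sub>0)"
proof
  assume *: "pos_semidef_on S R"
  show "\<forall>g. sesq S R g g \<in> \<real>\<^sub>\<ge>\<^sub>0"
  proof
    fix g
    show "sesq S R g g \<in> \<real>\<^sub>\<ge>\<^sub>0"
      using *[unfolded pos_semidef_on_def, rule_format, of "\<lambda>i. cnj (g i)"] by (simp add: sesq_def)
  qed
next
  assume *: "\<forall>g. sesq S R g g \<in> \<real>\<^sub>\<ge>\<^sub>0"
  show "pos_semidef_on S R"
    unfolding pos_semidef_on_def
  proof
    fix v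
    show "(\<Sum>i\<in>S. \<Sum>j\<in>S. cnj (v i) * R i j * v j) \<in> \<real>\<^sub>\<ge>\<^sub>0"
      using *[rule_format, of "\<lambda>i. cnj (v i)"] by (simp add: sesq_def)
  qed
qed

lemma sesq_cnj:
  assumes "hermitian_on S R"
  shows "cnj (sesq S R g h) = sesq S R h g"
proof -
  have R: "cnj (R i j) = R j i" if "i \<in> S" "j \<in> S" for i j
    using assms that unfolding hermitian_on_def by metis
  have "cnj (sesq S R g h) = (\<Sum>i\<in>S. \<Sum>j\<in>S. h j * R j i * cnj (g i))"
    unfolding sesq_def cnj_sum by (intro sum.cong refl) (simp add: R mult_ac)
  also have "\<dots> = sesq S R h g"
    unfolding sesq_def by (rule sum.swap)
  finally show ?thesis .
qed

lemma sesq_diff_left: "sesq S R (\<lambda>i. g i - t * f i) h = sesq S R g h - t * sesq S R f h"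
  by (simp add: sesq_def algebra_simps sum_subtractf sum_distrib_left)

lemma sesq_diff_right: "sesq S R g (\<lambda>i. h i - t * f i) = sesq S R g h - cnj t * sesq S R g f"
  by (simp add: sesq_def algebra_simps sum_subtractf sum_distrib_left)

lemma sesq_eq_sum_rows: "sesq S R g h = (\<Sum>j\<in>S. (\<Sum>i\<in>S. g i * R i j) * cnj (h j))"
  unfolding sesq_def sum_distrib_right by (rule sum.swap)

text \<open>
  Otherwise the value of the form at \<open>h - t g\<close> would be real affine in \<open>t\<close> and not constant, hence
  negative for a suitable \<open>t\<close>.
\<close>

lemma sesq_null:
  assumes herm: "hermitian_on S R" and psd: "pos_semidef_on S R" and null: "sesq S R g g = 0"
  shows "sesq S R g h = 0"
proof (rule ccontr)
  define z where "z = sesq S R g h"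
  assume "sesq S R g h \<noteq> 0"
  then have z: "norm z > 0" by (simp add: z_def)
  obtain r where r: "sesq S R h h = of_real r"
    using psd[unfolded pos_semidef_on_iff_sesq, rule_format, of h]
    by (auto elim: nonneg_Reals_cases)
  \<comment> \<open>The factor is chosen to give the form the value \<open>-1\<close> at \<open>h - t g\<close>.\<close>
  define t where "t = of_real ((r + 1) / (2 * (norm z)\<^sup>2)) * cnj z"
  have hg: "sesq S R h g = cnj z"
    using sesq_cnj[OF herm, of g h] by (simp add: z_def)
  have "t * z = of_real ((r + 1) / (2 * (norm z)\<^sup>2) * (norm z)\<^sup>2)"
    unfolding t_def of_real_mult complex_norm_square by (simp add: mult_ac)
  also have "\<dots> = of_real ((r + 1) / 2)"
    using z by simp
  finally have tz: "t * z = of_real ((r + 1) / 2)" .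
  then have tz': "cnj t * cnj z = of_real ((r + 1) / 2)"
    by (metis complex_cnj_complex_of_real complex_cnj_mult)
  have "sesq S R (\<lambda>i. h i - t * g i) (\<lambda>i. h i - t * g i) = of_real r - t * z - cnj t * cnj z"
    unfolding sesq_diff_left sesq_diff_right hg null r z_def[symmetric] by (simp add: algebra_simps)
  also have "\<dots> = of_real (r - (r + 1) / 2 - (r + 1) / 2)"
    unfolding tz tz' by simp
  also have "r - (r + 1) / 2 - (r + 1) / 2 = -1" by (simp add: field_simps)
  finally have "of_real (-1) \<in> (\<real>\<^sub>\<ge>\<^sub>0 :: complex set)"
    using psd[unfolded pos_semidef_on_iff_sesq, rule_format, of "\<lambda>i. h i - t * g i"] by simp
  then show False by (simp only: nonneg_Reals_of_real_iff)
qed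

text \<open>
  Isotropic vectors are linear relations between the rows. This is where positivity enters the
  definition of the shifts.
\<close>

lemma sesq_null_row:
  assumes "hermitian_on S R" "pos_semidef_on S R" "sesq S R g g = 0" "finite S" "j \<in> S"
  shows "(\<Sum>i\<in>S. g i * R i j) = 0"
proof -
  have "(\<Sum>i\<in>S. g i * R i j) = sesq S R g (\<lambda>k. if k = j then 1 else 0)"
    using assms(4,5) by (simp add: sesq_eq_sum_rows if_distrib[of cnj] if_distrib[of "(*) _"] cong: if_cong)
  then show ?thesis using sesq_null[OF assms(1-3)] by simp
qed

text \<open>
  The form after removal of the rank one matrix of the row \<open>p = f R\<close>. With \<open>a = f R f\<^sup>*\<close> this is the
  form on the orthogonal complement of \<open>f\<close>: the value vanishes if \<open>h = f\<close>.
\<close>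

lemma sesq_deflate:
  assumes herm: "hermitian_on S R" and row: "\<And>j. j \<in> S \<Longrightarrow> p j = (\<Sum>k\<in>S. f k * R k j)"
  shows "sesq S (\<lambda>i j. R i j - cnj (p i) * p j / a) g h = sesq S R g h - sesq S R g f * sesq S R f h / a"
proof -
  have "(\<Sum>i\<in>S. g i * cnj (p i)) = cnj (\<Sum>i\<in>S. p i * cnj (g i))"
    by (simp add: mult.commute)
  also have "(\<Sum>i\<in>S. p i * cnj (g i)) = sesq S R f g"
    by (simp add: sesq_eq_sum_rows row)
  finally have 1: "(\<Sum>i\<in>S. g i * cnj (p i)) = sesq S R g f"
    by (simp add: sesq_cnj[OF herm])
  have 2: "(\<Sum>j\<in>S. p j * cnj (h j)) = sesq S R f h"
    by (simp add: sesq_eq_sum_rows row)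
  have "sesq S (\<lambda>i j. R i j - cnj (p i) * p j / a) g h =
      sesq S R g h - (\<Sum>i\<in>S. \<Sum>j\<in>S. (g i * cnj (p i)) * (p j * cnj (h j)) / a)"
    by (simp add: sesq_def algebra_simps sum_subtractf)
  also have "(\<Sum>i\<in>S. \<Sum>j\<in>S. (g i * cnj (p i)) * (p j * cnj (h j)) / a) =
      (\<Sum>i\<in>S. g i * cnj (p i)) * (\<Sum>j\<in>S. p j * cnj (h j)) / a"
    by (simp add: sum_product sum_divide_distrib)
  finally show ?thesis by (simp add: 1 2)
qed

text \<open>
  The deflated form at \<open>g\<close> is the original form at \<open>g - t f\<close>, the component of \<open>g\<close> orthogonal to \<open>f\<close>.
\<close>

lemma pos_semidef_on_deflate:
  assumes herm: "hermitian_on S R" and psd: "pos_semidef_on S R"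
    and row: "\<And>j. j \<in> S \<Longrightarrow> p j = (\<Sum>k\<in>S. f k * R k j)" and a: "sesq S R f f = of_real a" "a \<noteq> 0"
  shows "pos_semidef_on S (\<lambda>i j. R i j - cnj (p i) * p j / of_real a)"
  unfolding pos_semidef_on_iff_sesq
proof
  fix g
  define t where "t = sesq S R g f / of_real a"
  have t: "cnj t = sesq S R f g / of_real a"
    by (simp add: t_def sesq_cnj[OF herm])
  have "sesq S R (\<lambda>i. g i - t * f i) (\<lambda>i. g i - t * f i) =
      sesq S R g g - t * sesq S R f g - cnj t * (sesq S R g f - t * of_real a)"
    by (simp add: sesq_diff_left sesq_diff_right a algebra_simps)
  also have "\<dots> = sesq S R g g - sesq S R g f * sesq S R f g / of_real a"
    using a(2) by (simp add: t_def)
  also have "\<dots> = sesq S (\<lambda>i j. R i j - cnj (p i) * p j / of_real a) g g"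
    by (rule sesq_deflate[OF herm row, symmetric])
  finally show "sesq S (\<lambda>i j. R i j - cnj (p i) * p j / of_real a) g g \<in> \<real>\<^sub>\<ge>\<^sub>0"
    using psd[unfolded pos_semidef_on_iff_sesq, rule_format, of "\<lambda>i. g i - t * f i"] by simp
qed

section \<open>Row spaces\<close>

definition row_on :: "'i set \<Rightarrow> ('i \<Rightarrow> 'i \<Rightarrow> complex) \<Rightarrow> 'i \<Rightarrow> 'i \<Rightarrow> complex" where
  "row_on S R i = (\<lambda>j. if j \<in> S then R i j else 0)"

definition row_space :: "'i set \<Rightarrow> ('i \<Rightarrow> 'i \<Rightarrow> complex) \<Rightarrow> ('i \<Rightarrow> complex) set" where
  "row_space S R = fun_space.span (row_on S R ` S)"

lemma rank_on_eq: "rank_on S R = fun_space.dim (row_on S R ` S)"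
  unfolding rank_on_def row_on_def ..

lemma span_rows_combination:
  assumes "w \<in> fun_space.span (row_on S R ` F)" "finite F"
  shows "\<exists>f. \<forall>j\<in>S. w j = (\<Sum>i\<in>F. f i * R i j)"
  using assms(1)
proof (induction rule: fun_space.span_induct_alt)
  case base
  show ?case by (intro exI[of _ "\<lambda>_. 0"]) simp
next
  case (step c x y)
  then obtain i f where i: "i \<in> F" "x = row_on S R i" "\<forall>j\<in>S. y j = (\<Sum>i\<in>F. f i * R i j)"
    by auto
  have "c * R i j + (\<Sum>k\<in>F. f k * R k j) = (\<Sum>k\<in>F. (f k + (if k = i then c else 0)) * R k j)" for j
    using i(1) \<open>finite F\<close>
    by (simp add: distrib_right sum.distrib if_distrib[of "\<lambda>c. c * _"] cong: if_cong)
  with i show ?case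
    by (intro exI[of _ "\<lambda>k. f k + (if k = i then c else 0)"]) (simp add: row_on_def)
qed

lemma span_rows_zero_outside:
  assumes "w \<in> fun_space.span (row_on S R ` F)" "j \<notin> S"
  shows "w j = 0"
  using assms(1)
proof (induction rule: fun_space.span_induct_alt)
  case (step c x y)
  then show ?case using assms(2) by (auto simp: row_on_def)
qed simp

text \<open>
  The index map \<open>k\<close> allows combinations of shifted rows. Membership of \<open>k i\<close> in \<open>G\<close> matters only where the
  coefficient is nonzero, so the sum may run over an index set larger than the support.
\<close>

lemma combination_in_span_rows:
  assumes "\<And>i. i \<in> F \<Longrightarrow> f i \<noteq> 0 \<Longrightarrow> k i \<in> G"
  shows "(\<lambda>j. if j \<in> S then \<Sum>i\<in>F. f i * R (k i) j else 0) \<in> fun_space.span (row_on S R ` G)"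
proof -
  have "(\<Sum>i\<in>F. (\<lambda>j. f i * row_on S R (k i) j)) \<in> fun_space.span (row_on S R ` G)"
  proof (rule fun_space.span_sum)
    fix i assume "i \<in> F"
    show "(\<lambda>j. f i * row_on S R (k i) j) \<in> fun_space.span (row_on S R ` G)"
    proof (cases "f i = 0")
      case True
      then show ?thesis using fun_space.span_zero by (simp add: zero_fun_def)
    next
      case False
      then show ?thesis
        using assms[OF \<open>i \<in> F\<close>] by (intro fun_space.span_scale fun_space.span_base) auto
    qed
  qed
  also have "(\<Sum>i\<in>F. (\<lambda>j. f i * row_on S R (k i) j)) =
      (\<lambda>j. if j \<in> S then \<Sum>i\<in>F. f i * R (k i) j else 0)"
    by (auto simp: fun_eq_iff sum_fun_apply row_on_def)
  finally show ?thesis .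
qed

text \<open>
  Flatness compares ranks of a matrix and of a principal submatrix, whose rows are shorter. A basis
  of the short rows lifts to full rows, which stay independent because restriction is linear; by
  equality of the ranks there are enough of them to span the full row space.
\<close>

lemma principal_rank_eq_imp_span_rows_eq:
  assumes "finite S" "S' \<subseteq> S" and rank: "rank_on S R = rank_on S' R"
  shows "fun_space.span (row_on S R ` S') = fun_space.span (row_on S R ` S)"
proof -
  obtain B where B: "B \<subseteq> row_on S' R ` S'" "fun_space.independent B" "card B = rank_on S' R"
    unfolding rank_on_eq by (blast intro: fun_space.basis_exists)
  then obtain I where I: "I \<subseteq> S'" "inj_on (row_on S' R) I" "B = row_on S' R ` I"
    by (metis subset_image_inj)
  have fin: "finite I" using I(1) assms(1,2) by (meson finite_subset)
  \<comment> \<open>Restriction sends each full row to the short row with the same index.\<close>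
  define restr where "restr w = (\<lambda>j. if j \<in> S' then w j else 0)" for w :: "'a \<Rightarrow> complex"
  have restr: "restr (row_on S R i) = row_on S' R i" for i
    using assms(2) by (auto simp: restr_def row_on_def fun_eq_iff)
  have inj: "inj_on (row_on S R) I"
    using I(2) restr by (metis inj_on_def)
  have indep: "fun_space.independent (row_on S R ` I)"
  proof
    assume "fun_space.dependent (row_on S R ` I)"
    then obtain u where u: "\<exists>v\<in>row_on S R ` I. u v \<noteq> 0"
        "(\<Sum>v\<in>row_on S R ` I. (\<lambda>x. u v * v x)) = 0"
      using fun_space.dependent_finite[of "row_on S R ` I"] fin by auto
    define u' where "u' v = u (row_on S R (inv_into I (row_on S' R) v))" for v
    have u': "u' (row_on S' R i) = u (row_on S R i)" if "i \<in> I" for i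
      using that I(2) by (simp add: u'_def)
    have "(\<Sum>v\<in>B. (\<lambda>x. u' v * v x)) = (\<Sum>i\<in>I. (\<lambda>x. u (row_on S R i) * row_on S' R i x))"
      unfolding I(3) using I(2) u' by (simp add: sum.reindex)
    also have "\<dots> = restr (\<Sum>i\<in>I. (\<lambda>x. u (row_on S R i) * row_on S R i x))"
      using assms(2) by (auto simp: fun_eq_iff sum_fun_apply restr_def row_on_def)
    also have "(\<Sum>i\<in>I. (\<lambda>x. u (row_on S R i) * row_on S R i x)) = 0"
      using u(2) inj by (simp add: sum.reindex)
    finally have "(\<Sum>v\<in>B. (\<lambda>x. u' v * v x)) = 0"
      by (simp add: restr_def fun_eq_iff)
    moreover have "\<exists>v\<in>B. u' v \<noteq> 0"
      using u(1) u' I(3) by auto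
    moreover have "finite B" using fin I(3) by simp
    ultimately have "fun_space.dependent B"
      using fun_space.dependent_finite[of B] by auto
    with B(2) show False by contradiction
  qed
  have card: "card (row_on S R ` I) = rank_on S R"
    using B(3) I(2,3) inj rank by (simp add: card_image)
  have "row_on S R i \<in> fun_space.span (row_on S R ` I)" if "i \<in> S" for i
  proof (rule ccontr)
    assume notin: "row_on S R i \<notin> fun_space.span (row_on S R ` I)"
    obtain C where C: "C \<subseteq> row_on S R ` S" "row_on S R ` S \<subseteq> fun_space.span C" "card C = rank_on S R"
      unfolding rank_on_eq by (blast intro: fun_space.basis_exists)
    have "finite C" using C(1) assms(1) by (meson finite_imageI finite_subset)
    moreover have "fun_space.independent (insert (row_on S R i) (row_on S R ` I))"
      using fun_space.independent_insertI[OF notin indep] .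
    moreover have "insert (row_on S R i) (row_on S R ` I) \<subseteq> fun_space.span C"
      using C(2) that I(1) assms(2) by blast
    ultimately have "card (insert (row_on S R i) (row_on S R ` I)) \<le> card C"
      using fun_space.independent_span_bound by blast
    moreover have "row_on S R i \<notin> row_on S R ` I"
      using notin fun_space.span_base by metis
    ultimately show False using fin card C(3) by simp
  qed
  then have "fun_space.span (row_on S R ` S) \<subseteq> fun_space.span (row_on S R ` I)"
    by (intro fun_space.span_minimal) auto
  moreover have "fun_space.span (row_on S R ` I) \<subseteq> fun_space.span (row_on S R ` S')"
    using I(1) by (intro fun_space.span_mono image_mono)
  moreover have "fun_space.span (row_on S R ` S') \<subseteq> fun_space.span (row_on S R ` S)"
    using assms(2) by (intro fun_space.span_mono image_mono)
  ultimately show ?thesis by blast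
qed

lemma dim_insert_outside_span:
  assumes "finite A" "x \<notin> fun_space.span A"
  shows "fun_space.dim (insert x A) = Suc (fun_space.dim A)"
proof -
  obtain B where B: "B \<subseteq> A" "fun_space.independent B" "A \<subseteq> fun_space.span B" "card B = fun_space.dim A"
    by (rule fun_space.basis_exists)
  have span: "fun_space.span B = fun_space.span A"
    using B(1,3) by (metis fun_space.span_mono fun_space.span_span subset_antisym)
  have "fun_space.independent (insert x B)"
    using assms(2) B(2) span by (intro fun_space.independent_insertI) auto
  moreover have "fun_space.span (insert x B) = fun_space.span (insert x A)"
    by (simp add: fun_space.span_insert span)
  ultimately have "fun_space.dim (insert x A) = card (insert x B)"
    by (intro fun_space.dim_eq_card)
  also have "\<dots> = Suc (card B)"
    using assms span fun_space.span_base[of x B] finite_subset[OF B(1)] by (subst card_insert_disjoint) auto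
  finally show ?thesis using B(4) by simp
qed

section \<open>Characters of the torus\<close>

lemma character_zero: "character 0 x = 1"
  by (simp add: character_def)

lemma character_add: "character (i + j) x = character i x * character j x"
  by (simp add: character_def exp_add[symmetric] distrib_right distrib_left sum.distrib)

lemma character_uminus: "character (- k) x = cnj (character k x)"
  by (simp add: character_def exp_cnj sum_negf)

lemma exists_character_axis_eq:
  fixes c :: "'d::finite \<Rightarrow> complex"
  assumes "\<And>n. norm (c n) = 1"
  shows "\<exists>x. \<forall>n. character (axis n 1) x = c n"
proof (intro exI allI)
  fix n
  define y where "y = (\<chi> m. - Arg (c m) / (2 * pi))"
  have "(\<Sum>m\<in>UNIV. of_int (axis n 1 $ m) * y $ m) = (\<Sum>m\<in>UNIV. if m = n then y $ m else 0)"
    by (intro sum.cong) (auto simp: axis_def)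
  then have "(\<Sum>m\<in>UNIV. of_int (axis n 1 $ m) * y $ m) = y $ n"
    by simp
  then have "character (axis n 1) (\<chi> m. abs_circle (y $ m)) = exp (\<i> * of_real (Arg (c n)))"
    unfolding character_abs_circle by (simp add: y_def)
  also have "\<dots> = c n"
    using assms[of n] by (metis cis_conv_exp cis_Arg norm_zero sgn_eq div_by_1 of_real_1 zero_neq_one)
  finally show "character (axis n 1) (\<chi> m. abs_circle (y $ m)) = c n" .
qed

text \<open>
  Representatives in \<open>\<real>\<close> cannot be chosen continuously, but each factor of the character is continuous
  on \<open>\<real>\<close> and has period one, so it descends to the quotient topology of the circle. Continuity gives
  the Borel measurability without which the integral would be zero by default.
\<close>

lemma continuous_on_character: "continuous_on UNIV (character k :: circle ^ 'd::finite \<Rightarrow> complex)"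
proof -
  define e where "e m t = exp (- 2 * \<i> * of_real pi * of_real (of_int m * rep_circle t))" for m :: int and t
  have e_abs: "e m (abs_circle y) = exp (- 2 * \<i> * of_real pi * of_real (of_int m * y))" for m y
  proof -
    have "of_int m * (rep_circle (abs_circle y) - y) \<in> \<int>"
      by (intro Ints_mult rep_abs_circle) auto
    then obtain N where "of_int m * (rep_circle (abs_circle y) - y) = of_int N"
      by (auto elim: Ints_cases)
    then have N: "of_int m * rep_circle (abs_circle y) = of_int m * y + of_int N"
      by (simp add: right_diff_distrib)
    show ?thesis
      unfolding e_def N unfolding exp_eq by (rule exI[of _ "- N"]) (simp add: algebra_simps)
  qed
  have e: "continuous_on UNIV (e m)" for m
  proof (subst continuous_on_open_vimage[OF open_UNIV], intro allI impI)
    fix B :: "complex set" assume "open B"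
    have "continuous_on UNIV (\<lambda>y::real. exp (- 2 * \<i> * of_real pi * of_real (of_int m * y)))"
      by (intro continuous_intros)
    then have "open ((\<lambda>y::real. exp (- 2 * \<i> * of_real pi * of_real (of_int m * y))) -` B)"
      using \<open>open B\<close> by (simp add: continuous_on_open_vimage)
    also have "(\<lambda>y::real. exp (- 2 * \<i> * of_real pi * of_real (of_int m * y))) -` B = abs_circle -` (e m -` B)"
      by (auto simp: e_abs)
    finally show "open (e m -` B \<inter> UNIV)"
      by (simp add: open_circle_def)
  qed
  have "character k x = (\<Prod>n\<in>UNIV. e (k $ n) (x $ n))" for x :: "circle ^ 'd"
    by (simp add: character_def e_def sum_distrib_left flip: exp_sum sum_negf)
  moreover have "continuous_on UNIV (\<lambda>x::circle ^ 'd. e (k $ n) (x $ n))" for n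
    by (rule continuous_on_compose2[OF e]) (auto intro: continuous_intros)
  ultimately show ?thesis by (simp add: continuous_on_prod)
qed

section \<open>Index boxes\<close>

lemma finite_Omega: "finite (Omega l :: (int ^ 'd::finite) set)"
proof -
  have "Omega l \<subseteq> vec_lambda ` (UNIV \<rightarrow>\<^sub>E {- int l..int l} :: ('d \<Rightarrow> int) set)"
  proof
    fix k :: "int ^ 'd" assume "k \<in> Omega l"
    then have "vec_nth k \<in> UNIV \<rightarrow>\<^sub>E {- int l..int l}"
      by (auto simp: Omega_def PiE_UNIV_domain abs_le_iff) (metis minus_le_iff)
    then show "k \<in> vec_lambda ` (UNIV \<rightarrow>\<^sub>E {- int l..int l} :: ('d \<Rightarrow> int) set)"
      by (metis image_eqI vec_nth_inverse)
  qed
  moreover have "finite (UNIV \<rightarrow>\<^sub>E {- int l..int l} :: ('d \<Rightarrow> int) set)"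
    by (intro finite_PiE) auto
  ultimately show ?thesis
    using finite_subset by blast
qed

lemma Omega_zero: "0 \<in> Omega l"
  by (simp add: Omega_def)

lemma Omega_diff_axis:
  assumes "j \<in> Omega (l - 1)" "1 \<le> l"
  shows "j - axis n 1 \<in> Omega l"
  unfolding Omega_def mem_Collect_eq
proof
  fix k
  have "\<bar>j $ k\<bar> \<le> int l - 1" using assms by (auto simp: Omega_def of_nat_diff)
  then show "\<bar>(j - axis n 1) $ k\<bar> \<le> int l" by (auto simp: axis_def)
qed

lemma Omega_add_axis:
  assumes "j \<in> Omega (l - 1)" "1 \<le> l"
  shows "j + axis n 1 \<in> Omega l"
  unfolding Omega_def mem_Collect_eq
proof
  fix k
  have "\<bar>j $ k\<bar> \<le> int l - 1" using assms by (auto simp: Omega_def of_nat_diff)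
  then show "\<bar>(j + axis n 1) $ k\<bar> \<le> int l" by (auto simp: axis_def)
qed

text \<open>
  For \<open>m = n\<close> this would fail: two steps in one direction may leave the larger box.
\<close>

lemma Omega_diff_axis_axis:
  assumes "j \<in> Omega (l - 1)" "1 \<le> l" "m \<noteq> n"
  shows "j - axis m 1 - axis n 1 \<in> Omega l"
  unfolding Omega_def mem_Collect_eq
proof
  fix k
  have "\<bar>j $ k\<bar> \<le> int l - 1" using assms by (auto simp: Omega_def of_nat_diff)
  then show "\<bar>(j - axis m 1 - axis n 1) $ k\<bar> \<le> int l" using assms(3) by (auto simp: axis_def)
qed

lemma Omega_pred_subset: "Omega (l - 1) \<subseteq> Omega l"
  by (auto simp: Omega_def intro: order_trans)

lemma Omega_towards_zero:
  assumes "j \<in> Omega l"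
  shows "0 < j $ n \<Longrightarrow> j - axis n 1 \<in> Omega l" "j $ n < 0 \<Longrightarrow> j + axis n 1 \<in> Omega l"
proof -
  have j: "\<bar>j $ k\<bar> \<le> int l" for k
    using assms by (simp add: Omega_def)
  show "j - axis n 1 \<in> Omega l" if "0 < j $ n"
    unfolding Omega_def mem_Collect_eq
  proof
    fix k show "\<bar>(j - axis n 1) $ k\<bar> \<le> int l"
      using j[of k] that by (auto simp: axis_def)
  qed
  show "j + axis n 1 \<in> Omega l" if "j $ n < 0"
    unfolding Omega_def mem_Collect_eq
  proof
    fix k show "\<bar>(j + axis n 1) $ k\<bar> \<le> int l"
      using j[of k] that by (auto simp: axis_def)
  qed
qed

text \<open>
  The row at index \<open>0\<close> of the moment matrix of the Dirac measure at \<open>x\<close>.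
\<close>

definition atom_row :: "nat \<Rightarrow> circle ^ 'd::finite \<Rightarrow> int ^ 'd \<Rightarrow> complex" where
  "atom_row l x = (\<lambda>j. if j \<in> Omega l then character (- j) x else 0)"

lemma atom_row_product:
  assumes "i \<in> Omega l" "j \<in> Omega l"
  shows "cnj (atom_row l x i) * atom_row l x j = character (i - j) x"
  using assms character_add[of i "- j" x] by (simp add: atom_row_def character_uminus)

section \<open>Shifts on the row space\<close>

text \<open>
  The form of the hypotheses that survives the removal of an atom. The Toeplitz property is stated
  for unit shifts, which generate all others, and flatness as an equality of row spaces.
\<close>

locale flat_toeplitz =
  fixes l :: nat and R :: "int ^ 'd::finite \<Rightarrow> int ^ 'd \<Rightarrow> complex"
  assumes l_pos: "1 \<le> l"
    and herm: "hermitian_on (Omega l) R"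
    and psd: "pos_semidef_on (Omega l) R"
    and toeplitz: "\<And>n i j. i \<in> Omega l \<Longrightarrow> j \<in> Omega l \<Longrightarrow> i + axis n 1 \<in> Omega l \<Longrightarrow>
      j + axis n 1 \<in> Omega l \<Longrightarrow> R (i + axis n 1) (j + axis n 1) = R i j"
    and flat_rows: "fun_space.span (row_on (Omega l) R ` Omega (l - 1)) =
      fun_space.span (row_on (Omega l) R ` Omega l)"
begin

abbreviation W :: "(int ^ 'd \<Rightarrow> complex) set" where
  "W \<equiv> row_space (Omega l) R"

lemma W_eq_inner: "W = fun_space.span (row_on (Omega l) R ` Omega (l - 1))"
  unfolding row_space_def by (rule flat_rows[symmetric])

lemma subspace_W: "fun_space.subspace W"
  by (simp add: row_space_def)

lemma W_zero_outside: "w \<in> W \<Longrightarrow> j \<notin> Omega l \<Longrightarrow> w j = 0"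
  unfolding row_space_def by (rule span_rows_zero_outside)

lemma W_inner_combination:
  assumes "w \<in> W"
  obtains f where "\<And>i. f i \<noteq> 0 \<Longrightarrow> i \<in> Omega (l - 1)"
    "\<And>j. j \<in> Omega l \<Longrightarrow> w j = (\<Sum>i\<in>Omega l. f i * R i j)"
proof -
  obtain f where f: "\<And>j. j \<in> Omega l \<Longrightarrow> w j = (\<Sum>i\<in>Omega (l - 1). f i * R i j)"
    using span_rows_combination[OF assms[unfolded W_eq_inner] finite_Omega] by blast
  define f' where "f' i = (if i \<in> Omega (l - 1) then f i else 0)" for i
  have "(\<Sum>i\<in>Omega (l - 1). f i * R i j) = (\<Sum>i\<in>Omega l. f' i * R i j)" for j
    by (intro sum.mono_neutral_cong_left finite_Omega Omega_pred_subset) (auto simp: f'_def)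
  then show ?thesis
    using f that[of f'] by (metis f'_def)
qed

text \<open>
  If \<open>u = f R\<close> vanishes on \<open>\<Omega>\<^bsub>\<ell>-1\<^esub>\<close> and \<open>f\<close> is supported there, then \<open>f R f\<^sup>* = 0\<close>, so \<open>f\<close> is a relation
  between the rows and \<open>u = 0\<close> on all of \<open>\<Omega>\<^sub>\<ell>\<close>.
\<close>

lemma W_eqI:
  assumes "w \<in> W" "w' \<in> W" and eq: "\<And>j. j \<in> Omega (l - 1) \<Longrightarrow> w j = w' j"
  shows "w = w'"
proof -
  have "w - w' \<in> W"
    using fun_space.subspace_diff[OF subspace_W assms(1,2)] .
  then obtain f where f: "\<And>i. f i \<noteq> 0 \<Longrightarrow> i \<in> Omega (l - 1)"
      "\<And>j. j \<in> Omega l \<Longrightarrow> (w - w') j = (\<Sum>i\<in>Omega l. f i * R i j)"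
    by (rule W_inner_combination) blast
  have "sesq (Omega l) R f f = (\<Sum>j\<in>Omega l. (w - w') j * cnj (f j))"
    by (simp add: sesq_eq_sum_rows f(2)[symmetric] del: fun_diff_def minus_apply)
  also have "\<dots> = 0"
  proof (rule sum.neutral, rule ballI)
    fix j
    show "(w - w') j * cnj (f j) = 0"
      using f(1)[of j] eq[of j] by (cases "f j = 0") auto
  qed
  finally have "(w - w') j = 0" if "j \<in> Omega l" for j
    using sesq_null_row[OF herm psd _ finite_Omega that] f(2)[OF that] by simp
  then show ?thesis
    using W_zero_outside[OF assms(1)] W_zero_outside[OF assms(2)] by (fastforce simp: fun_eq_iff)
qed

definition shift_row_comb :: "'d \<Rightarrow> (int ^ 'd \<Rightarrow> complex) \<Rightarrow> int ^ 'd \<Rightarrow> complex" where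
  "shift_row_comb n f = (\<lambda>j. if j \<in> Omega l then \<Sum>i\<in>Omega l. f i * R (i + axis n 1) j else 0)"

text \<open>
  The value \<open>w (j - e\<^sub>n)\<close> is unavailable on one face of the box; there \<open>w'\<close> is determined by
  membership in \<open>W\<close>.
\<close>

definition is_shift :: "'d \<Rightarrow> (int ^ 'd \<Rightarrow> complex) \<Rightarrow> (int ^ 'd \<Rightarrow> complex) \<Rightarrow> bool" where
  "is_shift n w w' \<longleftrightarrow> w' \<in> W \<and> (\<forall>j\<in>Omega l. j - axis n 1 \<in> Omega l \<longrightarrow> w' j = w (j - axis n 1))"

text \<open>
  Moving the rows of a combination by \<open>e\<^sub>n\<close> has the same effect as translating the function, by the
  Toeplitz property. Flatness provides coefficients on \<open>\<Omega>\<^bsub>\<ell>-1\<^esub>\<close>, which are the ones that can be moved.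
\<close>

lemma is_shift_shift_row_comb:
  assumes f: "\<And>i. f i \<noteq> 0 \<Longrightarrow> i \<in> Omega (l - 1)"
    and w: "\<And>j. j \<in> Omega l \<Longrightarrow> w j = (\<Sum>i\<in>Omega l. f i * R i j)"
  shows "is_shift n w (shift_row_comb n f)"
  unfolding is_shift_def
proof (intro conjI ballI impI)
  show "shift_row_comb n f \<in> W"
    unfolding shift_row_comb_def row_space_def
    by (rule combination_in_span_rows) (use f Omega_add_axis l_pos in blast)
next
  fix j assume j: "j \<in> Omega l" "j - axis n 1 \<in> Omega l"
  have "f i * R (i + axis n 1) j = f i * R i (j - axis n 1)" if "i \<in> Omega l" for i
    using toeplitz[of i "j - axis n 1" n] that j f[of i] Omega_add_axis[of i l n] l_pos by auto
  then have "(\<Sum>i\<in>Omega l. f i * R (i + axis n 1) j) = (\<Sum>i\<in>Omega l. f i * R i (j - axis n 1))"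
    by (rule sum.cong[OF refl])
  then show "shift_row_comb n f j = w (j - axis n 1)"
    using j by (simp add: shift_row_comb_def w)
qed

lemma is_shift_unique:
  assumes "is_shift n w w1" "is_shift n w w2"
  shows "w1 = w2"
proof (rule W_eqI)
  fix j :: "int ^ 'd" assume "j \<in> Omega (l - 1)"
  then have "j \<in> Omega l" "j - axis n 1 \<in> Omega l"
    using Omega_pred_subset Omega_diff_axis l_pos by blast+
  then show "w1 j = w2 j"
    using assms by (simp add: is_shift_def)
qed (use assms in \<open>auto simp: is_shift_def\<close>)

lemma is_shift_exists:
  assumes "w \<in> W"
  shows "\<exists>w'. is_shift n w w'"
proof -
  obtain f where f: "\<And>i. f i \<noteq> 0 \<Longrightarrow> i \<in> Omega (l - 1)"
      "\<And>j. j \<in> Omega l \<Longrightarrow> w j = (\<Sum>i\<in>Omega l. f i * R i j)"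
    using W_inner_combination[OF assms] by blast
  show ?thesis
    using is_shift_shift_row_comb[of f w n] f by blast
qed

definition shift :: "'d \<Rightarrow> (int ^ 'd \<Rightarrow> complex) \<Rightarrow> int ^ 'd \<Rightarrow> complex" where
  "shift n w = (SOME w'. is_shift n w w')"

lemma is_shift_shift: "w \<in> W \<Longrightarrow> is_shift n w (shift n w)"
  unfolding shift_def by (rule someI_ex[of "is_shift n w", OF is_shift_exists])

lemma shift_eqI:
  assumes "is_shift n w w'"
  shows "shift n w = w'"
  using someI[of "is_shift n w", OF assms] assms unfolding shift_def by (rule is_shift_unique)

lemma shift_in_W: "w \<in> W \<Longrightarrow> shift n w \<in> W"
  using is_shift_shift by (auto simp: is_shift_def)

lemma shift_apply:
  "w \<in> W \<Longrightarrow> j \<in> Omega l \<Longrightarrow> j - axis n 1 \<in> Omega l \<Longrightarrow> shift n w j = w (j - axis n 1)"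
  using is_shift_shift by (auto simp: is_shift_def)

lemma shift_add:
  assumes "v \<in> W" "w \<in> W"
  shows "shift n (v + w) = shift n v + shift n w"
  using assms fun_space.subspace_add[OF subspace_W shift_in_W shift_in_W, of v w n n]
  by (intro shift_eqI) (auto simp: is_shift_def shift_apply)

lemma shift_scale:
  assumes "w \<in> W"
  shows "shift n (\<lambda>x. c * w x) = (\<lambda>x. c * shift n w x)"
  using assms fun_space.subspace_scale[OF subspace_W shift_in_W, of w c n]
  by (intro shift_eqI) (auto simp: is_shift_def shift_apply)

text \<open>
  At an index \<open>j\<close> in \<open>\<Omega>\<^bsub>\<ell>-1\<^esub>\<close> both sides are \<open>w (j - e\<^sub>m - e\<^sub>n)\<close>, because for \<open>m \<noteq> n\<close> all indices on the way
  stay in \<open>\<Omega>\<^sub>\<ell>\<close>; and these values determine an element of \<open>W\<close>.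
\<close>

lemma shift_commute:
  assumes "w \<in> W"
  shows "shift m (shift n w) = shift n (shift m w)"
proof (cases "m = n")
  case False
  show ?thesis
  proof (rule W_eqI)
    fix j :: "int ^ 'd" assume j: "j \<in> Omega (l - 1)"
    have "j \<in> Omega l" and one: "\<And>k. j - axis k 1 \<in> Omega l"
      using j Omega_pred_subset Omega_diff_axis l_pos by blast+
    have two: "j - axis m 1 - axis n 1 \<in> Omega l" "j - axis n 1 - axis m 1 \<in> Omega l"
      using Omega_diff_axis_axis[OF j l_pos] False by metis+
    have "shift m (shift n w) j = w (j - axis m 1 - axis n 1)"
      by (simp add: shift_apply shift_in_W assms \<open>j \<in> Omega l\<close> one two)
    moreover have "shift n (shift m w) j = w (j - axis n 1 - axis m 1)"
      by (simp add: shift_apply shift_in_W assms \<open>j \<in> Omega l\<close> one two)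
    ultimately show "shift m (shift n w) j = shift n (shift m w) j"
      by (simp add: algebra_simps)
  qed (use assms in \<open>auto intro: shift_in_W\<close>)
qed simp

lemma sesq_self_nonzero:
  assumes w: "w \<in> W" "w \<noteq> 0" and f: "\<And>j. j \<in> Omega l \<Longrightarrow> w j = (\<Sum>i\<in>Omega l. f i * R i j)"
  shows "sesq (Omega l) R f f \<noteq> 0"
proof
  assume "sesq (Omega l) R f f = 0"
  then have "w j = 0" for j
    using sesq_null_row[OF herm psd _ finite_Omega, of f j] f[of j] W_zero_outside[OF w(1), of j]
    by (cases "j \<in> Omega l") auto
  with w(2) show False by (auto simp: fun_eq_iff)
qed

text \<open>
  The shift is isometric: moving the coefficients \<open>f\<close> of \<open>w = f R\<close> by \<open>e\<^sub>n\<close> leaves \<open>f R f\<^sup>*\<close> unchanged. For an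
  eigenvector the same number is multiplied by \<open>c\<close> through its first argument and by \<open>cnj c\<close> through
  its second, and it is not zero.
\<close>

lemma norm_shift_eigenvalue:
  assumes w: "w \<in> W" "w \<noteq> 0" and eigen: "shift n w = (\<lambda>j. c * w j)"
  shows "norm c = 1"
proof -
  let ?S = "Omega l :: (int ^ 'd) set"
  let ?e = "axis n 1 :: int ^ 'd"
  obtain f where f: "\<And>i. f i \<noteq> 0 \<Longrightarrow> i \<in> Omega (l - 1)"
      "\<And>j. j \<in> ?S \<Longrightarrow> w j = (\<Sum>i\<in>?S. f i * R i j)"
    using W_inner_combination[OF w(1)] by blast
  have inner: "f k = 0 \<or> k + ?e \<in> ?S" for k
    using f(1)[of k] Omega_add_axis l_pos by blast
  define q where "q = sesq ?S R f f"
  have "is_shift n w (shift_row_comb n f)"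
    using is_shift_shift_row_comb[of f w n] f by blast
  then have shift: "c * w j = (\<Sum>i\<in>?S. f i * R (i + ?e) j)" if "j \<in> ?S" for j
    using shift_eqI[of n w "shift_row_comb n f"] eigen that
    by (simp add: shift_row_comb_def fun_eq_iff)
  have "q = (\<Sum>k\<in>?S. (\<Sum>i\<in>?S. f i * R (i + ?e) (k + ?e)) * cnj (f k))"
    unfolding q_def sesq_eq_sum_rows
  proof (intro sum.cong refl)
    fix k assume k: "k \<in> ?S"
    have "(\<Sum>i\<in>?S. f i * R i k) = (\<Sum>i\<in>?S. f i * R (i + ?e) (k + ?e))" if "f k \<noteq> 0"
    proof (intro sum.cong refl)
      fix i assume "i \<in> ?S"
      then show "f i * R i k = f i * R (i + ?e) (k + ?e)"
        using inner[of i] inner[of k] that k toeplitz[of i k n] by auto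
    qed
    then show "(\<Sum>i\<in>?S. f i * R i k) * cnj (f k) = (\<Sum>i\<in>?S. f i * R (i + ?e) (k + ?e)) * cnj (f k)"
      by (cases "f k = 0") auto
  qed
  also have "\<dots> = (\<Sum>k\<in>?S. (c * w (k + ?e)) * cnj (f k))"
  proof (intro sum.cong refl)
    fix k
    show "(\<Sum>i\<in>?S. f i * R (i + ?e) (k + ?e)) * cnj (f k) = (c * w (k + ?e)) * cnj (f k)"
      using shift[of "k + ?e"] inner[of k] by auto
  qed
  also have "\<dots> = (\<Sum>k\<in>?S. (c * (\<Sum>i\<in>?S. f i * R i (k + ?e))) * cnj (f k))"
  proof (intro sum.cong refl)
    fix k
    show "(c * w (k + ?e)) * cnj (f k) = (c * (\<Sum>i\<in>?S. f i * R i (k + ?e))) * cnj (f k)"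
      using f(2)[of "k + ?e"] inner[of k] by auto
  qed
  also have "\<dots> = c * (\<Sum>i\<in>?S. f i * (\<Sum>k\<in>?S. R i (k + ?e) * cnj (f k)))"
    unfolding sum_distrib_left sum_distrib_right by (subst sum.swap) (simp add: mult_ac)
  also have "\<dots> = c * (\<Sum>i\<in>?S. f i * cnj (\<Sum>k\<in>?S. f k * R (k + ?e) i))"
  proof (intro arg_cong[of _ _ "(*) c"] sum.cong refl arg_cong[of _ _ "(*) (f _)"])
    fix i assume i: "i \<in> ?S"
    have "R i (k + ?e) * cnj (f k) = cnj (f k * R (k + ?e) i)" for k
      using inner[of k] i herm by (auto simp: hermitian_on_def)
    then show "(\<Sum>k\<in>?S. R i (k + ?e) * cnj (f k)) = cnj (\<Sum>k\<in>?S. f k * R (k + ?e) i)"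
      unfolding cnj_sum by (intro sum.cong refl)
  qed
  also have "\<dots> = c * (\<Sum>i\<in>?S. f i * cnj (c * w i))"
    using shift by simp
  also have "\<dots> = c * cnj c * cnj (\<Sum>i\<in>?S. w i * cnj (f i))"
    by (simp add: sum_distrib_left mult_ac)
  also have "(\<Sum>i\<in>?S. w i * cnj (f i)) = q"
    unfolding q_def sesq_eq_sum_rows using f(2) by simp
  also have "cnj q = q"
    unfolding q_def by (rule sesq_cnj[OF herm])
  finally have "c * cnj c = 1"
    using sesq_self_nonzero[OF w f(2)] by (simp add: q_def)
  then have "(norm c)\<^sup>2 = 1"
    by (metis complex_norm_square of_real_1 of_real_eq_iff)
  then show ?thesis
    by (simp add: power2_eq_1_iff) (metis norm_ge_zero neg_0_le_iff_le not_one_le_zero)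
qed

section \<open>Splitting off an atom\<close>

text \<open>
  A common eigenvector satisfies \<open>v (j - e\<^sub>n) = c\<^sub>n v j\<close>, so walking from \<open>j\<close> to \<open>0\<close> by unit steps inside the box
  expresses \<open>v j\<close> through \<open>v 0\<close>. Since the \<open>c\<^sub>n\<close> are unimodular they are the values of the characters \<open>e\<^sub>n\<close> at a
  point of the torus.
\<close>

lemma exists_atom_row_in_W:
  assumes "w \<in> W" "w \<noteq> 0"
  shows "\<exists>x. atom_row l x \<in> W"
proof -
  have "\<exists>v\<in>W. v \<noteq> 0 \<and> (\<forall>n\<in>UNIV. \<exists>c. shift n v = (\<lambda>x. c * v x))"
    by (rule common_eigenvector_exists[of UNIV W "row_on (Omega l) R ` Omega l"])
      (use assms in \<open>auto simp: subspace_W finite_Omega row_space_def[symmetric] shift_in_W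
        shift_add shift_scale shift_commute\<close>)
  then obtain v c where v: "v \<in> W" "v \<noteq> 0" and c: "\<And>n. shift n v = (\<lambda>x. c n * v x)"
    by (auto dest!: choice)
  have norm: "norm (c n) = 1" for n
    using norm_shift_eigenvalue[OF v c] .
  obtain x where x: "\<And>n. character (axis n 1) x = c n"
    using exists_character_axis_eq[of c] norm by blast
  have v_eq: "v j = v 0 * character (- j) x" if "j \<in> Omega l" for j
    using that
  proof (induction "\<Sum>n\<in>UNIV. nat \<bar>j $ n\<bar>" arbitrary: j rule: less_induct)
    case less
    show ?case
    proof (cases "j = 0")
      case True
      then show ?thesis by (simp add: character_zero)
    next
      case False
      then obtain n where n: "j $ n \<noteq> 0" by (auto simp: vec_eq_iff)
      show ?thesis
      proof (cases "0 < j $ n")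
        case True
        define i where "i = j - axis n 1"
        have i: "i \<in> Omega l" using Omega_towards_zero(1)[OF less.prems True] by (simp add: i_def)
        have "(\<Sum>m\<in>UNIV. nat \<bar>i $ m\<bar>) < (\<Sum>m\<in>UNIV. nat \<bar>j $ m\<bar>)"
          using True by (intro sum_strict_mono_ex1) (auto simp: i_def axis_def intro!: exI[of _ n])
        then have "v i = v 0 * character (- i) x" using less.hyps i by blast
        moreover have "c n * v j = v i"
          using shift_apply[OF v(1) less.prems, of n] i c[of n] by (simp add: i_def)
        moreover have "character (- i) x = c n * character (- j) x"
          using character_add[of "axis n 1" "- j" x] x by (simp add: i_def)
        moreover have "c n \<noteq> 0" using norm[of n] by auto
        ultimately show ?thesis by simp
      next
        case False
        with n have neg: "j $ n < 0" by simp
        define i where "i = j + axis n 1"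
        have i: "i \<in> Omega l" using Omega_towards_zero(2)[OF less.prems neg] by (simp add: i_def)
        have "(\<Sum>m\<in>UNIV. nat \<bar>i $ m\<bar>) < (\<Sum>m\<in>UNIV. nat \<bar>j $ m\<bar>)"
          using neg by (intro sum_strict_mono_ex1) (auto simp: i_def axis_def intro!: exI[of _ n])
        then have "v i = v 0 * character (- i) x" using less.hyps i by blast
        moreover have "c n * v i = v j"
          using shift_apply[OF v(1) i, of n] less.prems c[of n] by (simp add: i_def)
        moreover have "character (- j) x = c n * character (- i) x"
          using character_add[of "axis n 1" "- i" x] x by (simp add: i_def)
        ultimately show ?thesis by (metis mult.left_commute)
      qed
    qed
  qed
  have "v 0 \<noteq> 0"
  proof
    assume "v 0 = 0"
    then have "v j = 0" for j
      using v_eq[of j] W_zero_outside[OF v(1), of j] by (cases "j \<in> Omega l") auto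
    with v(2) show False by (auto simp: fun_eq_iff)
  qed
  then have "atom_row l x = (\<lambda>j. inverse (v 0) * v j)"
    using v_eq W_zero_outside[OF v(1)] by (auto simp: atom_row_def fun_eq_iff)
  then have "atom_row l x \<in> W"
    using fun_space.subspace_scale[OF subspace_W v(1), of "inverse (v 0)"] by simp
  then show ?thesis ..
qed

text \<open>
  The atom at \<open>x\<close> gets the weight \<open>1 / f R f\<^sup>*\<close>, where \<open>f R\<close> is its row. This is the largest multiple of its
  moment matrix that can be subtracted without losing positivity, which is why the rank drops.
\<close>

lemma split_off_atom:
  assumes atom: "atom_row l x \<in> W"
  shows "\<exists>R' a. 0 < a \<and> flat_toeplitz l R' \<and>
    (\<forall>i\<in>Omega l. \<forall>j\<in>Omega l. R i j = R' i j + of_real a * character (i - j) x) \<and>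
    row_space (Omega l) R' \<subseteq> W \<and> atom_row l x \<notin> row_space (Omega l) R' \<and>
    rank_on (Omega l) R = Suc (rank_on (Omega l) R')"
proof -
  let ?S = "Omega l :: (int ^ 'd) set"
  define p where "p = atom_row l x"
  obtain f where f: "\<And>j. j \<in> ?S \<Longrightarrow> p j = (\<Sum>i\<in>?S. f i * R i j)"
    using W_inner_combination[OF atom] unfolding p_def by blast
  have "p 0 = 1"
    by (simp add: p_def atom_row_def Omega_zero character_zero)
  then have "p \<noteq> 0" by auto
  then have "sesq ?S R f f \<noteq> 0"
    using sesq_self_nonzero[of p f] atom f by (simp add: p_def)
  moreover obtain a where a: "sesq ?S R f f = of_real a" "0 \<le> a"
    using psd[unfolded pos_semidef_on_iff_sesq, rule_format, of f] by (auto elim: nonneg_Reals_cases)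
  ultimately have a_pos: "0 < a" by auto
  define R' where "R' = (\<lambda>i j. R i j - cnj (p i) * p j / of_real a)"
  have R'_eq: "R' i j = R i j - character (i - j) x / of_real a" if "i \<in> ?S" "j \<in> ?S" for i j
    using atom_row_product[OF that, of x] by (simp add: R'_def p_def)
  have cnj_R: "cnj (R i j) = R j i" if "i \<in> ?S" "j \<in> ?S" for i j
    using herm that unfolding hermitian_on_def by metis
  have cnj_p: "cnj (p i) = (\<Sum>m\<in>?S. R i m * cnj (f m))" if "i \<in> ?S" for i
    unfolding f[OF that] cnj_sum
    by (intro sum.cong refl) (simp add: cnj_R that mult.commute)
  have row': "row_on ?S R' i = row_on ?S R i - (\<lambda>j. cnj (p i) / of_real a * p j)" for i
    by (auto simp: row_on_def R'_def p_def atom_row_def fun_eq_iff)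

  \<comment> \<open>A relation \<open>R\<^sub>i = \<Sum> g\<^sub>k R\<^sub>k\<close> between rows also holds for \<open>cnj (p i)\<close>, a pairing of \<open>R\<^sub>i\<close> with \<open>f\<close>.\<close>
  have flat': "row_on ?S R' i \<in> fun_space.span (row_on ?S R' ` Omega (l - 1))" if i: "i \<in> ?S" for i
  proof -
    have "row_on ?S R i \<in> W"
      unfolding row_space_def using i by (intro fun_space.span_base) auto
    then obtain g where g: "\<And>k. g k \<noteq> 0 \<Longrightarrow> k \<in> Omega (l - 1)"
        "\<And>j. j \<in> ?S \<Longrightarrow> row_on ?S R i j = (\<Sum>k\<in>?S. g k * R k j)"
      using W_inner_combination by blast
    have Rg: "R i j = (\<Sum>k\<in>?S. g k * R k j)" if "j \<in> ?S" for j
      using g(2)[OF that] that by (simp add: row_on_def)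
    have "cnj (p i) = (\<Sum>m\<in>?S. (\<Sum>k\<in>?S. g k * R k m) * cnj (f m))"
      unfolding cnj_p[OF i] by (intro sum.cong refl) (simp add: Rg)
    also have "\<dots> = (\<Sum>k\<in>?S. \<Sum>m\<in>?S. g k * (R k m * cnj (f m)))"
      unfolding sum_distrib_right mult.assoc by (rule sum.swap)
    also have "\<dots> = (\<Sum>k\<in>?S. g k * cnj (p k))"
      by (intro sum.cong refl) (simp add: cnj_p sum_distrib_left)
    finally have pg: "cnj (p i) = (\<Sum>k\<in>?S. g k * cnj (p k))" .
    have "R' i j = (\<Sum>k\<in>?S. g k * R' k j)" if "j \<in> ?S" for j
      unfolding R'_def pg Rg[OF that]
      by (simp add: right_diff_distrib sum_subtractf sum_distrib_right sum_divide_distrib mult.assoc)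
    then have "row_on ?S R' i = (\<lambda>j. if j \<in> ?S then \<Sum>k\<in>?S. g k * R' k j else 0)"
      by (auto simp: row_on_def fun_eq_iff)
    also have "\<dots> \<in> fun_space.span (row_on ?S R' ` Omega (l - 1))"
      by (rule combination_in_span_rows) (rule g(1))
    finally show ?thesis .
  qed

  have "flat_toeplitz l R'"
  proof
    show "hermitian_on ?S R'"
      unfolding hermitian_on_def R'_def by (simp add: cnj_R mult.commute)
    show "pos_semidef_on ?S R'"
      unfolding R'_def using a(1) a_pos f by (intro pos_semidef_on_deflate[OF herm psd]) auto
    show "R' (i + axis n 1) (j + axis n 1) = R' i j"
      if "i \<in> ?S" "j \<in> ?S" "i + axis n 1 \<in> ?S" "j + axis n 1 \<in> ?S" for n i j
      using toeplitz[OF that] R'_eq[OF that(1,2)] R'_eq[OF that(3,4)] by simp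
    show "fun_space.span (row_on ?S R' ` Omega (l - 1)) = fun_space.span (row_on ?S R' ` ?S)"
    proof (rule antisym)
      show "fun_space.span (row_on ?S R' ` Omega (l - 1)) \<subseteq> fun_space.span (row_on ?S R' ` ?S)"
        by (intro fun_space.span_mono image_mono Omega_pred_subset)
      show "fun_space.span (row_on ?S R' ` ?S) \<subseteq> fun_space.span (row_on ?S R' ` Omega (l - 1))"
        using flat' by (intro fun_space.span_minimal fun_space.subspace_span) blast
    qed
  qed (rule l_pos)

  have pW: "p \<in> W" using atom by (simp add: p_def)
  have row'_W: "row_on ?S R' i \<in> W" if "i \<in> ?S" for i
    unfolding row'
    by (intro fun_space.subspace_diff[OF subspace_W] fun_space.subspace_scale[OF subspace_W pW])
      (use that in \<open>auto simp: row_space_def intro: fun_space.span_base\<close>)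
  then have sub: "row_space ?S R' \<subseteq> W"
    unfolding row_space_def[of _ R'] by (intro fun_space.span_minimal subspace_W) blast

  \<comment> \<open>The rows of \<open>R'\<close> are orthogonal to \<open>f\<close>, whereas pairing \<open>p\<close> with \<open>f\<close> gives \<open>a\<close>.\<close>
  have notin: "p \<notin> row_space ?S R'"
  proof
    assume "p \<in> row_space ?S R'"
    then obtain g where g: "\<And>j. j \<in> ?S \<Longrightarrow> p j = (\<Sum>i\<in>?S. g i * R' i j)"
      using span_rows_combination[OF _ finite_Omega] unfolding row_space_def by blast
    have "sesq ?S R f f = (\<Sum>j\<in>?S. p j * cnj (f j))"
      by (simp add: sesq_eq_sum_rows f)
    also have "\<dots> = sesq ?S R' g f"
      by (simp add: sesq_eq_sum_rows g)
    also have "\<dots> = sesq ?S R g f - sesq ?S R g f * sesq ?S R f f / of_real a"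
      unfolding R'_def by (rule sesq_deflate[OF herm f])
    also have "\<dots> = 0"
      using a(1) a_pos by simp
    finally show False using a(1) a_pos by simp
  qed

  have "fun_space.span (insert p (row_on ?S R' ` ?S)) = W"
  proof (rule antisym)
    show "fun_space.span (insert p (row_on ?S R' ` ?S)) \<subseteq> W"
      using row'_W pW by (intro fun_space.span_minimal subspace_W) blast
    have "row_on ?S R i \<in> fun_space.span (insert p (row_on ?S R' ` ?S))" if "i \<in> ?S" for i
    proof -
      have "row_on ?S R' i + (\<lambda>j. cnj (p i) / of_real a * p j)
          \<in> fun_space.span (insert p (row_on ?S R' ` ?S))"
        using that by (intro fun_space.span_add fun_space.span_scale fun_space.span_base) auto
      then show ?thesis by (simp add: row')
    qed
    then show "W \<subseteq> fun_space.span (insert p (row_on ?S R' ` ?S))"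
      unfolding row_space_def by (intro fun_space.span_minimal fun_space.subspace_span) blast
  qed
  then have "rank_on ?S R = fun_space.dim (insert p (row_on ?S R' ` ?S))"
    unfolding rank_on_eq row_space_def by (rule fun_space.span_eq_dim[symmetric])
  also have "\<dots> = Suc (rank_on ?S R')"
    unfolding rank_on_eq using notin finite_Omega
    by (intro dim_insert_outside_span) (auto simp: row_space_def)
  finally have rank: "rank_on ?S R = Suc (rank_on ?S R')" .

  show ?thesis
  proof (intro exI[of _ R'] exI[of _ "1 / a"] conjI ballI)
    show "R i j = R' i j + of_real (1 / a) * character (i - j) x" if "i \<in> ?S" "j \<in> ?S" for i j
      using R'_eq[OF that] by simp
  qed (use a_pos \<open>flat_toeplitz l R'\<close> sub notin rank in \<open>auto simp: p_def\<close>)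
qed

end

text \<open>
  The clause that the atoms lie in the row space is carried through the induction for distinctness: a
  new atom is outside the row space that contains all the others.
\<close>

lemma flat_toeplitz_atomic:
  fixes R :: "int ^ 'd::finite \<Rightarrow> int ^ 'd \<Rightarrow> complex"
  assumes "flat_toeplitz l R"
  shows "\<exists>X a. finite X \<and> card X = rank_on (Omega l) R \<and> (\<forall>x\<in>X. 0 < a x) \<and>
    (\<forall>x\<in>X. atom_row l x \<in> row_space (Omega l) R) \<and>
    (\<forall>i\<in>Omega l. \<forall>j\<in>Omega l. R i j = (\<Sum>x\<in>X. of_real (a x) * character (i - j) x))"
  using assms
proof (induction "rank_on (Omega l) R" arbitrary: R rule: less_induct)
  case less
  interpret flat_toeplitz l R by (rule less.prems)
  show ?case
  proof (cases "\<exists>w\<in>W. w \<noteq> 0")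
    case False
    then have zero: "row_on (Omega l) R i = 0" if "i \<in> Omega l" for i
      using that fun_space.span_base[of "row_on (Omega l) R i" "row_on (Omega l) R ` Omega l"]
      unfolding row_space_def by blast
    have "R i j = 0" if "i \<in> Omega l" "j \<in> Omega l" for i j
      using fun_cong[OF zero[OF that(1)], of j] that(2) by (simp add: row_on_def)
    moreover have "fun_space.span {} = W"
      using False fun_space.subspace_0[OF subspace_W] by (auto simp: fun_space.span_empty)
    then have "rank_on (Omega l) R = 0"
      unfolding rank_on_eq row_space_def
      using fun_space.dim_eq_card[OF _ fun_space.independent_empty] by simp
    ultimately show ?thesis
      by (intro exI[of _ "{}"]) auto
  next
    case True
    then obtain x where "atom_row l x \<in> W"
      using exists_atom_row_in_W by blast
    then obtain R' b where b: "0 < b" and R': "flat_toeplitz l R'"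
        "\<And>i j. i \<in> Omega l \<Longrightarrow> j \<in> Omega l \<Longrightarrow> R i j = R' i j + of_real b * character (i - j) x"
        "row_space (Omega l) R' \<subseteq> W" "atom_row l x \<notin> row_space (Omega l) R'"
        "rank_on (Omega l) R = Suc (rank_on (Omega l) R')"
      using split_off_atom by blast
    obtain X a where X: "finite X" "card X = rank_on (Omega l) R'" "\<forall>x\<in>X. 0 < a x"
        "\<forall>x\<in>X. atom_row l x \<in> row_space (Omega l) R'"
        "\<forall>i\<in>Omega l. \<forall>j\<in>Omega l. R' i j = (\<Sum>x\<in>X. of_real (a x) * character (i - j) x)"
      using less.hyps[OF _ R'(1)] R'(5) by auto
    have "x \<notin> X" using X(4) R'(4) by blast
    have "(\<Sum>y\<in>insert x X. of_real ((a(x := b)) y) * character (i - j) y) =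
        of_real b * character (i - j) x + (\<Sum>y\<in>X. of_real (a y) * character (i - j) y)" for i j
      using X(1) \<open>x \<notin> X\<close> by (auto intro!: sum.cong)
    then show ?thesis
      using X R' b \<open>x \<notin> X\<close> \<open>atom_row l x \<in> W\<close>
      by (intro exI[of _ "insert x X"] exI[of _ "a(x := b)"]) auto
  qed
qed

section \<open>The representing measure\<close>

text \<open>
  The measure is the image of a weighted counting measure on \<open>{1..card X}\<close> under an enumeration of \<open>X\<close>,
  so integrals against it reduce to finite sums.
\<close>

lemma sparse_measure_with_atoms:
  fixes X :: "'a::topological_space set" and a :: "'a \<Rightarrow> real"
  assumes "finite X" and pos: "\<And>x. x \<in> X \<Longrightarrow> 0 < a x"
  shows "\<exists>\<nu>. sparse_measure (card X) \<nu> \<and>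
    (\<forall>g :: 'a \<Rightarrow> complex. g \<in> borel_measurable borel \<longrightarrow> (\<integral>x. g x \<partial>\<nu>) = (\<Sum>x\<in>X. of_real (a x) * g x))"
proof -
  obtain x where x: "bij_betw x {1..card X} X"
    using ex_bij_betw_nat_finite_1[OF \<open>finite X\<close>] by blast
  then have xX: "x n \<in> X" if "n \<in> {1..card X}" for n
    using that by (auto simp: bij_betw_def)
  define M where "M = point_measure {1..card X} (\<lambda>n. ennreal (a (x n)))"
  have meas: "x \<in> measurable M borel"
    by (simp add: M_def)
  define \<nu> where "\<nu> = distr M borel x"
  have emeasure: "emeasure \<nu> B = (\<Sum>n=1..card X. ennreal (a (x n)) * emeasure (return borel (x n)) B)"
    if B: "B \<in> sets borel" for B
  proof -
    have "emeasure \<nu> B = emeasure M (x -` B \<inter> {1..card X})"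
      unfolding \<nu>_def using meas B by (subst emeasure_distr) (auto simp: M_def space_point_measure)
    also have "\<dots> = (\<Sum>n\<in>x -` B \<inter> {1..card X}. ennreal (a (x n)))"
      unfolding M_def by (rule emeasure_point_measure_finite) auto
    also have "\<dots> = (\<Sum>n=1..card X. ennreal (a (x n)) * emeasure (return borel (x n)) B)"
      using B by (intro sum.mono_neutral_cong_left) (auto simp: indicator_def)
    finally show ?thesis .
  qed
  have "sparse_measure (card X) \<nu>"
    unfolding sparse_measure_def
    using x emeasure pos xX
    by (intro conjI exI[of _ "\<lambda>n. a (x n)"] exI[of _ x]) (auto simp: \<nu>_def bij_betw_def)
  moreover have "(\<integral>y. g y \<partial>\<nu>) = (\<Sum>y\<in>X. of_real (a y) * g y)" if "g \<in> borel_measurable borel" for g :: "'a \<Rightarrow> complex"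
  proof -
    have "(\<integral>y. g y \<partial>\<nu>) = (\<integral>n. g (x n) \<partial>M)"
      unfolding \<nu>_def using meas that by (intro integral_distr) auto
    also have "\<dots> = (\<Sum>n=1..card X. a (x n) *\<^sub>R g (x n))"
      unfolding M_def using pos xX by (intro lebesgue_integral_point_measure_finite) (auto intro: less_imp_le)
    also have "\<dots> = (\<Sum>y\<in>X. of_real (a y) * g y)"
      unfolding scaleR_conv_of_real using sum.reindex_bij_betw[OF x] .
    finally show ?thesis .
  qed
  ultimately show ?thesis by blast
qed

theorem theorem1:
  fixes l :: nat and R :: "int ^ 'd \<Rightarrow> int ^ 'd \<Rightarrow> complex"
  assumes "l \<ge> 2"
    and "hermitian_on (Omega l) R"
    and "pos_semidef_on (Omega l) R"
    and "gen_toeplitz l R"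
    and "flat l R"
  shows "\<exists>\<nu> :: (circle ^ 'd) measure.
    sparse_measure (rank_on (Omega l) R) \<nu> \<and> moment_matrix_of l R \<nu>"
proof -
  have "flat_toeplitz l R"
  proof
    show "R (i + axis n 1) (j + axis n 1) = R i j"
      if "i \<in> Omega l" "j \<in> Omega l" "i + axis n 1 \<in> Omega l" "j + axis n 1 \<in> Omega l" for n i j
    proof -
      have "axis n 1 \<in> Omega l"
        using \<open>l \<ge> 2\<close> by (auto simp: Omega_def axis_def)
      with that \<open>gen_toeplitz l R\<close> show ?thesis
        unfolding gen_toeplitz_def by blast
    qed
    show "fun_space.span (row_on (Omega l) R ` Omega (l - 1)) =
        fun_space.span (row_on (Omega l) R ` Omega l)"
      using \<open>flat l R\<close> unfolding flat_def
      by (intro principal_rank_eq_imp_span_rows_eq finite_Omega Omega_pred_subset)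
  qed (use assms in auto)
  then obtain X a where X: "finite X" "card X = rank_on (Omega l) R" "\<forall>x\<in>X. 0 < a x"
      "\<forall>i\<in>Omega l. \<forall>j\<in>Omega l. R i j = (\<Sum>x\<in>X. of_real (a x) * character (i - j) x)"
    by (elim flat_toeplitz_atomic[THEN exE] exE conjE)
  obtain \<nu> where \<nu>: "sparse_measure (card X) \<nu>"
      "\<And>g :: circle ^ 'd \<Rightarrow> complex. g \<in> borel_measurable borel \<Longrightarrow>
        (\<integral>x. g x \<partial>\<nu>) = (\<Sum>x\<in>X. of_real (a x) * g x)"
    using sparse_measure_with_atoms[OF X(1), of a] X(3) by blast
  have "moment_matrix_of l R \<nu>"
    unfolding moment_matrix_of_def
    using X(4) by (simp add: \<nu>(2) borel_measurable_continuous_onI continuous_on_character)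
  with \<nu>(1) X(2) show ?thesis by auto
qed

end
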